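(* Let $A\in\mathbb{R}^{n\times n}$, $B\in\mathbb{R}^{n\times m}$, and let $\mathcal{D}=\{(U_i,X_{0,i},X_i)\}_{i=1}^{M}$ be a (noiseless) dataset generated by the system $x(t+1)=Ax(t)+Bu(t)$ with experiment horizons $T_1,\dots,T_M$, as described in the context. Let $T\ge1$, let $k_1,\dots,k_\ell\in\{1,\dots,M\}$ be (possibly repeated) indices such that $\sum_{i=1}^{\ell}T_{k_i}=T$, and let $x_0,x_{\mathrm f}\in\mathbb{R}^n$ be such that $x_{\mathrm f}$ is reachable in $T$ steps from $x_0$. Assume that $\begin{bmatrix}X_{0,k_i}\\ U_{k_i}\end{bmatrix}$ has full row rank for all $i\in\{1,\dots,\ell\}$. Then the $T$-steps minimum-energy control input $u_T^*$ driving the system from $x_0$ to $x_{\mathrm f}$ can be expressed as $$u_T^*=\hat C_T^{\dagger}\begin{bmatrix}-Q_\ell Q_{\ell-1}\cdots Q_1& I\end{bmatrix}\begin{bmatrix}x_0\\ x_{\mathrm f}\end{bmatrix},$$ where $$\hat C_T=\begin{bmatrix}L_\ell& Q_\ell L_{\ell-1}&\cdots&Q_\ell Q_{\ell-1}\cdots Q_2L_1\end{bmatrix}$$ and, for all $i\in\{1,\dots,\ell\}$, $$Q_i=X_{k_i}K_{U_{k_i}}(X_{0,k_i}K_{U_{k_i}})^{\dagger},\qquad L_i=X_{k_i}K_{X_{0,k_i}}(U_{k_i}K_{X_{0,k_i}})^{\dagger}.$$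
   Context: System: $x(t+1)=Ax(t)+Bu(t)$, $x(0)=x_0\in\mathbb{R}^n$, with $x(t)\in\mathbb{R}^n$, $u(t)\in\mathbb{R}^m$. The $T$-steps controllability matrix is $C_T=[B\ \ AB\ \cdots\ A^{T-1}B]$. A $T$-steps input sequence is written in reversed time order as $u_T=[u(T-1)^{\mathsf T},\dots,u(0)^{\mathsf T}]^{\mathsf T}\in\mathbb{R}^{mT}$, so that $x(T)=A^Tx(0)+C_Tu_T$. Dataset: there are $M$ distinct horizons $T_1,\dots,T_M\in\mathbb{N}$ (positive integers). For each $i$, $N_i$ experiments of horizon $T_i$ are performed with arbitrary inputs and initial states. $U_i\in\mathbb{R}^{mT_i\times N_i}$, $X_{0,i}\in\mathbb{R}^{n\times N_i}$, $X_i\in\mathbb{R}^{n\times N_i}$ collect as columns the input sequences (each stacked in reversed time order, i.e. as $[u(T_i-1)^{\mathsf T},\dots,u(0)^{\mathsf T}]^{\mathsf T}$), the initial states, and the states at time $T_i$, respectively; thus $X_i=A^{T_i}X_{0,i}+C_{T_i}U_i$. Reachability: $x_{\mathrm f}$ is reachable in $T$ steps from $x_0$ if $x_{\mathrm f}-A^Tx_0\in\operatorname{Im}(C_T)$. Minimum-energy control: $u_T^*$ is the unique minimizer of $\|u_T\|_2^2$ over $u_T\in\mathbb{R}^{mT}$ subject to $x(t+1)=Ax(t)+Bu(t)$, $x(0)=x_0$, $x(T)=x_{\mathrm f}$; under reachability, $u_T^*=C_T^\dagger(x_{\mathrm f}-A^Tx_0)$. Notation: $A^\dagger$ is the Moore–Penrose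 pseudoinverse; $K_A$ is a matrix whose columns form a basis of $\operatorname{Ker}(A)$ (any fixed choice of basis). *)

theory Defs
  imports "Jordan_Normal_Form.Matrix_Kernel" "Jordan_Normal_Form.DL_Rank"
begin

text \<open>Moore--Penrose pseudoinverse of a real matrix, by the four Penrose conditions.\<close>

definition is_pinv :: "real mat \<Rightarrow> real mat \<Rightarrow> bool" where
  "is_pinv A P \<longleftrightarrow>
     P \<in> carrier_mat (dim_col A) (dim_row A) \<and>
     A * P * A = A \<and> P * A * P = P \<and>
     transpose_mat (A * P) = A * P \<and> transpose_mat (P * A) = P * A"

definition pinv :: "real mat \<Rightarrow> real mat" where
  "pinv A = (THE P. is_pinv A P)"

text \<open>The condition \<open>distinct\<close> is needed because \<open>set\<close> would hide repeated columns.
  If the kernel is trivial, \<open>K\<close> has no columns.\<close>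

definition kernel_basis_mat :: "real mat \<Rightarrow> real mat \<Rightarrow> bool" where
  "kernel_basis_mat A K \<longleftrightarrow>
     dim_row K = dim_col A \<and> distinct (cols K) \<and> kernel.basis (dim_col A) A (set (cols K))"

definition mat_image :: "real mat \<Rightarrow> real vec set" where
  "mat_image A = (\<lambda>v. A *\<^sub>v v) ` carrier_vec (dim_col A)"

definition full_row_rank :: "real mat \<Rightarrow> bool" where
  "full_row_rank A \<longleftrightarrow> vec_space.rank (dim_row A) A = dim_row A"

text \<open>Horizontal concatenation of blocks that all have \<open>n\<close> rows.\<close>

definition hcat :: "nat \<Rightarrow> real mat list \<Rightarrow> real mat" where
  "hcat n As = mat_of_cols n (concat (map cols As))"

definition ctrb :: "real mat \<Rightarrow> real mat \<Rightarrow> nat \<Rightarrow> real mat" where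
  "ctrb A B T = hcat (dim_row A) (map (\<lambda>t. A ^\<^sub>m t * B) [0..<T])"

text \<open>A stacked input of horizon \<open>T\<close> is in reversed time order: its leading block of length \<open>m\<close>
  is \<open>u(T-1)\<close>, its last one is \<open>u(0)\<close>.  The following is the input \<open>u(t)\<close>, for \<open>t < T\<close>.\<close>

definition input_at :: "nat \<Rightarrow> nat \<Rightarrow> real vec \<Rightarrow> nat \<Rightarrow> real vec" where
  "input_at m T v t = vec m (\<lambda>j. v $ ((T - 1 - t) * m + j))"

primrec state :: "real mat \<Rightarrow> real mat \<Rightarrow> (nat \<Rightarrow> real vec) \<Rightarrow> real vec \<Rightarrow> nat \<Rightarrow> real vec" where
  "state A B u x0 0 = x0"
| "state A B u x0 (Suc t) = A *\<^sub>v state A B u x0 t + B *\<^sub>v u t"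

definition final_state :: "real mat \<Rightarrow> real mat \<Rightarrow> nat \<Rightarrow> real vec \<Rightarrow> real vec \<Rightarrow> real vec" where
  "final_state A B T x0 v = state A B (input_at (dim_col B) T v) x0 T"

definition reachable :: "real mat \<Rightarrow> real mat \<Rightarrow> nat \<Rightarrow> real vec \<Rightarrow> real vec \<Rightarrow> bool" where
  "reachable A B T x0 xf \<longleftrightarrow> xf - A ^\<^sub>m T *\<^sub>v x0 \<in> mat_image (ctrb A B T)"

definition min_energy_control ::
    "real mat \<Rightarrow> real mat \<Rightarrow> nat \<Rightarrow> real vec \<Rightarrow> real vec \<Rightarrow> real vec \<Rightarrow> bool" where
  "min_energy_control A B T x0 xf =
     is_arg_min (\<lambda>v. v \<bullet> v) (\<lambda>v. v \<in> carrier_vec (dim_col B * T) \<and> final_state A B T x0 v = xf)"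

text \<open>Batch \<open>k \<in> {1..M}\<close> consists of \<open>N k\<close> experiments of horizon \<open>Ts k\<close>; column \<open>j\<close> of \<open>U k\<close>,
  \<open>X0 k\<close> and \<open>X k\<close> holds the stacked input, the initial state and the final state of
  experiment \<open>j\<close>.\<close>

definition generated_dataset ::
    "real mat \<Rightarrow> real mat \<Rightarrow> nat \<Rightarrow> (nat \<Rightarrow> nat) \<Rightarrow> (nat \<Rightarrow> nat) \<Rightarrow>
     (nat \<Rightarrow> real mat) \<Rightarrow> (nat \<Rightarrow> real mat) \<Rightarrow> (nat \<Rightarrow> real mat) \<Rightarrow> bool" where
  "generated_dataset A B M Ts N U X0 X \<longleftrightarrow>
     inj_on Ts {1..M} \<and>
     (\<forall>k\<in>{1..M}.
        Ts k \<ge> 1 \<and>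
        U k \<in> carrier_mat (dim_col B * Ts k) (N k) \<and>
        X0 k \<in> carrier_mat (dim_row A) (N k) \<and>
        X k \<in> carrier_mat (dim_row A) (N k) \<and>
        (\<forall>j<N k. col (X k) j = final_state A B (Ts k) (col (X0 k) j) (col (U k) j)))"

text \<open>\<open>rev_prod n Q a b\<close> is \<open>Q b * \<dots> * Q (a + 1) * Q a\<close>, the identity if \<open>b < a\<close>.\<close>

definition rev_prod :: "nat \<Rightarrow> (nat \<Rightarrow> real mat) \<Rightarrow> nat \<Rightarrow> nat \<Rightarrow> real mat" where
  "rev_prod n Q a b = fold (\<lambda>i P. Q i * P) [a..<Suc b] (1\<^sub>m n)"

definition ctrb_hat :: "nat \<Rightarrow> (nat \<Rightarrow> real mat) \<Rightarrow> (nat \<Rightarrow> real mat) \<Rightarrow> nat \<Rightarrow> real mat" where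
  "ctrb_hat n Q L l = hcat n (map (\<lambda>i. rev_prod n Q (Suc i) l * L i) (rev [1..<Suc l]))"

end

theory Submission
  imports Defs
begin

text \<open>Since \<open>[X\<^sub>0; U]\<close> has full row rank, every pair (initial state, input) is the image of some
  vector.  On the kernel of \<open>U\<close> the relation \<open>X = A^T X\<^sub>0 + C\<^sub>T U\<close> reduces to
  \<open>X K\<^sub>U = A^T X\<^sub>0 K\<^sub>U\<close>, where \<open>X\<^sub>0 K\<^sub>U\<close> is onto, so that its pseudoinverse is a right inverse and
  \<open>Q = A^T\<close>; symmetrically \<open>L = C\<^sub>T\<close>.  As \<open>C\<close> for horizon \<open>a + b\<close> is \<open>[C\<^sub>a, A^a C\<^sub>b]\<close>, the blocks
  assemble to the controllability matrix of the whole horizon, and the control is the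
  least-norm solution of a linear system.\<close>

section \<open>The Moore--Penrose pseudoinverse\<close>

text \<open>With premises about dimensions instead of carriers, the law serves as a conditional
  rewrite rule whose intermediate sizes need not be supplied. The next two lemmas follow the same
  pattern.\<close>

lemma assoc_mult_mat_dim:
  fixes A B C :: "'a :: semiring_0 mat"
  assumes "dim_col A = dim_row B" and "dim_col B = dim_row C"
  shows "(A * B) * C = A * (B * C)"
  by (rule assoc_mult_mat[of _ "dim_row A" "dim_row B" _ "dim_row C" _ "dim_col C"])
     (use assms in \<open>auto intro: carrier_matI\<close>)

lemma assoc_mult_mat_vec_dim:
  fixes A B :: "'a :: semiring_0 mat"
  assumes "dim_col A = dim_row B" and "dim_col B = dim_vec v"
  shows "(A * B) *\<^sub>v v = A *\<^sub>v (B *\<^sub>v v)"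
  by (rule assoc_mult_mat_vec[of _ "dim_row A" "dim_row B" _ "dim_col B"])
     (use assms in \<open>auto intro: carrier_matI carrier_vecI\<close>)

lemma transpose_mult_dim:
  fixes A B :: "'a :: comm_semiring_0 mat"
  assumes "dim_col A = dim_row B"
  shows "(A * B)\<^sup>T = B\<^sup>T * A\<^sup>T"
  by (rule transpose_mult[of _ "dim_row A" "dim_row B" _ "dim_col B"])
     (use assms in \<open>auto intro: carrier_matI\<close>)

lemma mat_eq_by_mult_vec:
  fixes A B :: "'a :: semiring_1 mat"
  assumes "A \<in> carrier_mat nr nc" and "B \<in> carrier_mat nr nc"
    and "\<And>v. v \<in> carrier_vec nc \<Longrightarrow> A *\<^sub>v v = B *\<^sub>v v"
  shows "A = B"
proof (rule eq_matI)
  fix i j assume ij: "i < dim_row B" "j < dim_col B"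
  have "(A *\<^sub>v unit_vec nc j) $ i = (B *\<^sub>v unit_vec nc j) $ i"
    by (subst assms(3)) auto
  then show "A $$ (i, j) = B $$ (i, j)"
    using ij assms(1,2) by simp
qed (use assms in auto)

section \<open>Least squares and orthogonal projections\<close>

lemma real_vec_scalar_self_eq_0:
  fixes r :: "real vec"
  assumes "r \<in> carrier_vec n" and "r \<bullet> r = 0"
  shows "r = 0\<^sub>v n"
proof (rule eq_vecI)
  fix i assume i: "i < dim_vec (0\<^sub>v n)"
  have "(\<Sum>j\<in>{0..<n}. r $ j * r $ j) = 0"
    using assms by (simp add: scalar_prod_def)
  then have "\<forall>j\<in>{0..<n}. r $ j * r $ j = 0"
    by (subst (asm) sum_nonneg_eq_0_iff) auto
  then show "r $ i = 0\<^sub>v n $ i" using i by auto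
qed (use assms in auto)

text \<open>Moving \<open>A\<close> across the inner product leaves one term per column, so
  coordinates with \<open>y $ i = 0\<close> and columns orthogonal to \<open>s\<close> drop
  out.\<close>

lemma scalar_mult_mat_vec_coord:
  fixes A :: "real mat"
  assumes "A \<in> carrier_mat nr nc" and "s \<in> carrier_vec nr" and "y \<in> carrier_vec nc"
  shows "(A *\<^sub>v y) \<bullet> s = (\<Sum>i<nc. y $ i * (col A i \<bullet> s))"
proof -
  have "(A *\<^sub>v y) \<bullet> s = y \<bullet> (A\<^sup>T *\<^sub>v s)"
    using transpose_vec_mult_scalar[OF assms(1,3,2)] assms
    by (metis comm_scalar_prod mult_mat_vec_carrier transpose_carrier_mat)
  also have "\<dots> = (\<Sum>i<nc. y $ i * (col A i \<bullet> s))"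
    using assms by (simp add: scalar_prod_def lessThan_atLeast0)
  finally show ?thesis .
qed

text \<open>Gram--Schmidt in disguise: the columns are made orthogonal to the residual one at a time,
  and the correction for column \<open>k\<close> uses the residual \<open>r\<close> of that column itself.  If \<open>r = 0\<close>, the
  coefficient \<open>(r \<bullet> s) / (r \<bullet> r)\<close> is \<open>0\<close> and the correction is vacuous.\<close>

lemma least_squares_prefix:
  fixes A :: "real mat"
  assumes A: "A \<in> carrier_mat nr nc" and "k \<le> nc" and "b \<in> carrier_vec nr"
  shows "\<exists>x\<in>carrier_vec nc. (\<forall>j. k \<le> j \<longrightarrow> j < nc \<longrightarrow> x $ j = 0) \<and>
           (\<forall>i<k. col A i \<bullet> (b - A *\<^sub>v x) = 0)"
  using assms(2,3)
proof (induction k arbitrary: b)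
  case 0
  show ?case by (rule bexI[of _ "0\<^sub>v nc"]) auto
next
  case (Suc k)
  let ?w = "A *\<^sub>v unit_vec nc k"
  have k: "k \<le> nc" "k < nc" using Suc.prems by auto
  have col_k: "col A k = ?w"
    using A k by (intro eq_vecI) auto
  obtain x where x: "x \<in> carrier_vec nc" "\<And>j. k \<le> j \<Longrightarrow> j < nc \<Longrightarrow> x $ j = 0"
      "\<And>i. i < k \<Longrightarrow> col A i \<bullet> (b - A *\<^sub>v x) = 0"
    using Suc.IH[OF k(1) Suc.prems(2)] by blast
  obtain y where y: "y \<in> carrier_vec nc" "\<And>j. k \<le> j \<Longrightarrow> j < nc \<Longrightarrow> y $ j = 0"
      "\<And>i. i < k \<Longrightarrow> col A i \<bullet> (?w - A *\<^sub>v y) = 0"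
    using Suc.IH[OF k(1), of ?w] A by fastforce
  define r where "r = ?w - A *\<^sub>v y"
  define s where "s = b - A *\<^sub>v x"
  define c where "c = (r \<bullet> s) / (r \<bullet> r)"
  \<comment> \<open>Moving along \<open>unit_vec nc k - y\<close> changes the residual by a multiple
    of \<open>r\<close> only. As \<open>r\<close> is orthogonal to the earlier columns, what was
    achieved for them survives, and no coordinate beyond \<open>k\<close> becomes nonzero.\<close>
  define z where "z = x + c \<cdot>\<^sub>v (unit_vec nc k - y)"
  have rs: "r \<in> carrier_vec nr" "s \<in> carrier_vec nr" and z: "z \<in> carrier_vec nc"
    using A x y Suc.prems by (auto simp: r_def s_def z_def)
  have ci: "col A i \<in> carrier_vec nr" for i using A by auto
  have "A *\<^sub>v z = A *\<^sub>v x + c \<cdot>\<^sub>v r"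
    using A x y unfolding z_def r_def
    by (simp add: mult_add_distrib_mat_vec[of _ nr nc] mult_mat_vec[of _ nr nc]
        mult_minus_distrib_mat_vec[of _ nr nc])
  then have res: "b - A *\<^sub>v z = s - c \<cdot>\<^sub>v r"
    using A x rs Suc.prems unfolding s_def by (intro eq_vecI) auto
  have Az: "col A i \<bullet> (b - A *\<^sub>v z) = col A i \<bullet> s - c * (col A i \<bullet> r)" for i
    unfolding res using rs ci[of i] by (simp add: scalar_prod_minus_distrib[of _ nr])
  have lt: "col A i \<bullet> (b - A *\<^sub>v z) = 0" if "i < k" for i
    using x(3)[OF that] y(3)[OF that] unfolding Az by (simp add: r_def s_def)
  have span_y: "(A *\<^sub>v y) \<bullet> t = 0" if "t \<in> carrier_vec nr" "\<And>i. i < k \<Longrightarrow> col A i \<bullet> t = 0" for t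
    unfolding scalar_mult_mat_vec_coord[OF A that(1) y(1)]
    by (rule sum.neutral) (metis lessThan_iff mult_eq_0_iff not_le that(2) y(2))
  have w_split: "?w = r + A *\<^sub>v y"
    using A rs y unfolding r_def by (intro eq_vecI) auto
  \<comment> \<open>Column \<open>k\<close> and \<open>r\<close> differ by a combination of earlier
    columns, so both have the same inner product with any \<open>t\<close> orthogonal to those.
    Taking \<open>t\<close> as \<open>s\<close> and as \<open>r\<close> shows that \<open>c\<close>
    is the right coefficient.\<close>
  have "col A k \<bullet> t = r \<bullet> t" if "t \<in> carrier_vec nr" "\<And>i. i < k \<Longrightarrow> col A i \<bullet> t = 0" for t
    unfolding col_k w_split using span_y[OF that] that(1) rs A y
    by (subst add_scalar_prod_distrib[of _ nr]) auto
  then have "col A k \<bullet> s = r \<bullet> s" "col A k \<bullet> r = r \<bullet> r"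
    using x(3) y(3) rs by (auto simp: r_def s_def)
  \<comment> \<open>In the degenerate case division by zero gives \<open>c = 0\<close>, so
    \<open>s\<close> itself has to be orthogonal to column \<open>k\<close>.\<close>
  moreover have "r \<bullet> s = 0" if "r \<bullet> r = 0"
    using real_vec_scalar_self_eq_0[OF rs(1) that] rs by simp
  ultimately have "col A k \<bullet> (b - A *\<^sub>v z) = 0"
    unfolding Az c_def by (cases "r \<bullet> r = 0") auto
  moreover have "\<forall>j. Suc k \<le> j \<longrightarrow> j < nc \<longrightarrow> z $ j = 0"
    using x y unfolding z_def by auto
  ultimately show ?case using z lt less_Suc_eq by auto
qed

text \<open>With all \<open>nc\<close> columns included, the residual is orthogonal to the whole
  range of \<open>A\<close>. The least-squares solutions for the unit vectors form the columns of
  \<open>R\<close>.\<close>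

lemma normal_equations_solvable:
  fixes A :: "real mat"
  assumes A: "A \<in> carrier_mat nr nc"
  shows "\<exists>R\<in>carrier_mat nc nr. A\<^sup>T * (A * R) = A\<^sup>T"
proof -
  have "\<exists>x\<in>carrier_vec nc. A\<^sup>T *\<^sub>v (b - A *\<^sub>v x) = 0\<^sub>v nc" if "b \<in> carrier_vec nr" for b
    using least_squares_prefix[OF A le_refl that] A by (metis (no_types, lifting) carrier_matD(2)
        dim_mult_mat_vec eq_vecI index_mult_mat_vec index_transpose_mat(2) index_zero_vec row_transpose)
  then obtain f where f: "\<And>b. b \<in> carrier_vec nr \<Longrightarrow> f b \<in> carrier_vec nc"
    "\<And>b. b \<in> carrier_vec nr \<Longrightarrow> A\<^sup>T *\<^sub>v (b - A *\<^sub>v f b) = 0\<^sub>v nc"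
    by metis
  define R where "R = mat_of_cols nc (map (\<lambda>j. f (unit_vec nr j)) [0..<nr])"
  have R: "R \<in> carrier_mat nc nr" by (auto simp: R_def)
  have colR: "col R j = f (unit_vec nr j)" if "j < nr" for j
    using that f(1) unfolding R_def by (subst col_mat_of_cols) auto
  have "A\<^sup>T * (A * R) = A\<^sup>T"
  proof (rule mat_col_eqI)
    fix j assume "j < dim_col A\<^sup>T"
    then have j: "j < nr" using A by simp
    let ?e = "unit_vec nr j :: real vec"
    have At: "A\<^sup>T \<in> carrier_mat nc nr" using A by simp
    have "A\<^sup>T *\<^sub>v ?e - A\<^sup>T *\<^sub>v (A *\<^sub>v f ?e) = 0\<^sub>v nc"
      using f[of ?e] A by (subst mult_minus_distrib_mat_vec[OF At, symmetric]) auto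
    then have "A\<^sup>T *\<^sub>v (A *\<^sub>v f ?e) = A\<^sup>T *\<^sub>v ?e"
      using A f(1)[of ?e] unfolding vec_eq_iff by auto
    moreover have "A\<^sup>T *\<^sub>v ?e = col A\<^sup>T j"
      using At j by (intro eq_vecI) auto
    moreover have "col (A\<^sup>T * (A * R)) j = A\<^sup>T *\<^sub>v (A *\<^sub>v col R j)"
      using col_mult2[OF At mult_carrier_mat[OF A R] j] col_mult2[OF A R j] by simp
    ultimately show "col (A\<^sup>T * (A * R)) j = col A\<^sup>T j"
      using colR[OF j] by simp
  qed (use A R in auto)
  then show ?thesis using R by blast
qed

text \<open>The transposed normal equations read \<open>(A * R)\<^sup>T * A = A\<close>. Multiplied
  by \<open>R\<close> on the right, their left side becomes \<open>(A * R)\<^sup>T\<close> by the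
  normal equations again, which gives the symmetry.\<close>

lemma orthogonal_projection_range:
  fixes A :: "real mat"
  assumes A: "A \<in> carrier_mat nr nc"
  shows "\<exists>R\<in>carrier_mat nc nr. A * R * A = A \<and> (A * R)\<^sup>T = A * R"
proof -
  obtain R where R: "R \<in> carrier_mat nc nr" and eq: "A\<^sup>T * (A * R) = A\<^sup>T"
    using normal_equations_solvable[OF A] by blast
  have dims: "dim_row A = nr" "dim_col A = nc" "dim_row R = nc" "dim_col R = nr"
    using A R by auto
  have "(A * R)\<^sup>T * A = A"
    using arg_cong[OF eq, of transpose_mat] by (simp add: transpose_mult_dim dims)
  moreover have sym: "(A * R)\<^sup>T = A * R"
  proof -
    have "(A * R)\<^sup>T = R\<^sup>T * (A\<^sup>T * (A * R))"
      unfolding eq by (simp add: transpose_mult_dim dims)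
    also have "\<dots> = ((A * R)\<^sup>T * A) * R"
      by (simp add: transpose_mult_dim assoc_mult_mat_dim dims)
    finally show ?thesis using \<open>(A * R)\<^sup>T * A = A\<close> by simp
  qed
  ultimately show ?thesis using R by auto
qed

text \<open>The projection lemma, applied to \<open>A\<close> and to its transpose, yields the
  projections \<open>A * R\<close> onto the column space and \<open>F\<close> onto the row space.
  For \<open>P = F * R\<close> the products \<open>A * P\<close> and \<open>P * A\<close> are
  exactly these two.\<close>

lemma is_pinv_exists: "\<exists>P. is_pinv A P"
proof -
  have A: "A \<in> carrier_mat (dim_row A) (dim_col A)" by auto
  obtain R where R: "R \<in> carrier_mat (dim_col A) (dim_row A)" "A * R * A = A" "(A * R)\<^sup>T = A * R"
    using orthogonal_projection_range[OF A] by blast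
  have At: "A\<^sup>T \<in> carrier_mat (dim_col A) (dim_row A)" by auto
  obtain S where S: "S \<in> carrier_mat (dim_row A) (dim_col A)" "A\<^sup>T * S * A\<^sup>T = A\<^sup>T"
      "(A\<^sup>T * S)\<^sup>T = A\<^sup>T * S"
    using orthogonal_projection_range[OF At] by blast
  define F where "F = A\<^sup>T * S"
  have dims: "dim_row R = dim_col A" "dim_col R = dim_row A" "dim_row S = dim_row A"
      "dim_col S = dim_col A" "dim_row F = dim_col A" "dim_col F = dim_col A"
    using R S by (auto simp: F_def)
  have AF: "A * F = A"
    using arg_cong[OF S(2), of transpose_mat] S(3)
    by (simp add: transpose_mult_dim assoc_mult_mat_dim dims F_def)
  have FS: "F = S\<^sup>T * A"
    using S(3) by (simp add: transpose_mult_dim dims F_def)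
  define P where "P = F * R"
  have AP: "A * P = A * R"
    unfolding P_def using AF by (simp add: assoc_mult_mat_dim[symmetric] dims)
  have PA: "P * A = F"
    unfolding P_def FS using R(2) by (simp add: assoc_mult_mat_dim dims)
  have FP: "F * P = P"
  proof -
    have "F * F = F" unfolding FS using AF[unfolded FS] by (simp add: assoc_mult_mat_dim dims)
    then show ?thesis
      unfolding P_def by (simp add: assoc_mult_mat_dim[symmetric] dims)
  qed
  have "is_pinv A P"
    unfolding is_pinv_def
  proof (intro conjI)
    show "P \<in> carrier_mat (dim_col A) (dim_row A)"
      by (rule carrier_matI) (simp_all add: P_def dims)
    show "A * P * A = A" "(A * P)\<^sup>T = A * P"
      unfolding AP using R by auto
    show "P * A * P = P" "(P * A)\<^sup>T = P * A"
      unfolding PA using FP S(3) by (auto simp: F_def)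
  qed
  then show ?thesis by blast
qed

text \<open>Symmetry lets the factors of \<open>A * P = (A * P') * (A * P)\<close> be exchanged,
  whence \<open>A * P = A * P'\<close>; likewise on the other side. Finally
  \<open>P = P * A * P\<close> is recovered from the two products.\<close>

lemma is_pinv_unique:
  assumes "is_pinv A P" and "is_pinv A P'"
  shows "P = P'"
proof -
  note dP = assms(1)[unfolded is_pinv_def] and dP' = assms(2)[unfolded is_pinv_def]
  have dims: "dim_row P = dim_col A" "dim_col P = dim_row A"
      "dim_row P' = dim_col A" "dim_col P' = dim_row A"
    using dP dP' by auto
  have "A * P = (A * P') * (A * P)"
    using dP' by (simp add: assoc_mult_mat_dim[symmetric] dims)
  then have "(A * P)\<^sup>T = (A * P)\<^sup>T * (A * P')\<^sup>T"
    by (metis transpose_mult_dim dims index_mult_mat(2,3))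
  then have l: "A * P = A * P'"
    using dP dP' by (simp add: assoc_mult_mat_dim[symmetric] dims)
  have "P * A = (P * A) * (P' * A)"
    using dP' by (simp add: assoc_mult_mat_dim dims)
  then have "(P * A)\<^sup>T = (P' * A)\<^sup>T * (P * A)\<^sup>T"
    by (metis transpose_mult_dim dims index_mult_mat(2,3))
  then have r: "P * A = P' * A"
    using dP dP' by (simp add: assoc_mult_mat_dim dims)
  have "P = P * (A * P)" using dP by (simp add: assoc_mult_mat_dim dims)
  also have "\<dots> = P' * A * P'" unfolding l using r by (simp add: assoc_mult_mat_dim[symmetric] dims)
  finally show ?thesis using dP' by simp
qed

lemma is_pinv_pinv: "is_pinv A (pinv A)"
  unfolding pinv_def using is_pinv_exists is_pinv_unique by (metis theI)

lemma pinv_carrier: "A \<in> carrier_mat nr nc \<Longrightarrow> pinv A \<in> carrier_mat nc nr"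
  using is_pinv_pinv[of A] by (auto simp: is_pinv_def)

text \<open>Every vector is some \<open>A *\<^sub>v w\<close>, and there \<open>A * pinv A\<close>
  acts as the identity by the first Penrose condition.\<close>

lemma mult_pinv_of_surj:
  assumes A: "A \<in> carrier_mat nr nc"
    and surj: "\<And>v. v \<in> carrier_vec nr \<Longrightarrow> \<exists>w\<in>carrier_vec nc. A *\<^sub>v w = v"
  shows "A * pinv A = 1\<^sub>m nr"
proof (rule mat_eq_by_mult_vec[of _ nr nr])
  note P = pinv_carrier[OF A]
  show "A * pinv A \<in> carrier_mat nr nr" using A P by auto
  fix v :: "real vec" assume v: "v \<in> carrier_vec nr"
  then obtain w where w: "w \<in> carrier_vec nc" "A *\<^sub>v w = v" using surj by blast
  have "(A * pinv A) *\<^sub>v v = (A * pinv A * A) *\<^sub>v w"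
    using A P v w by (auto simp: assoc_mult_mat_vec_dim)
  also have "A * pinv A * A = A" using is_pinv_pinv[of A] by (simp add: is_pinv_def)
  finally show "(A * pinv A) *\<^sub>v v = 1\<^sub>m nr *\<^sub>v v" using w v by simp
qed auto

text \<open>\<open>pinv C * C\<close> is the orthogonal projection onto the orthogonal complement of the kernel, so
  any two solutions differ by a vector orthogonal to \<open>pinv C *\<^sub>v d\<close>.\<close>

lemma min_norm_solution:
  assumes C: "C \<in> carrier_mat n N" and d: "d \<in> mat_image C"
  shows "is_arg_min (\<lambda>v. v \<bullet> v) (\<lambda>v. v \<in> carrier_vec N \<and> C *\<^sub>v v = d) u \<longleftrightarrow> u = pinv C *\<^sub>v d"
proof -
  note P = pinv_carrier[OF C]
  have pc: "C * pinv C * C = C" and sym: "(pinv C * C)\<^sup>T = pinv C * C"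
    using is_pinv_pinv[of C] by (auto simp: is_pinv_def)
  define p where "p = pinv C *\<^sub>v d"
  obtain v0 where v0: "v0 \<in> carrier_vec N" "d = C *\<^sub>v v0"
    using d C by (auto simp: mat_image_def)
  have p: "p \<in> carrier_vec N" using P C v0 by (auto simp: p_def)
  have "C *\<^sub>v p = (C * pinv C * C) *\<^sub>v v0"
    unfolding p_def v0(2) using C P v0(1) by (simp add: assoc_mult_mat_vec_dim)
  then have Cp: "C *\<^sub>v p = d" using pc v0 by simp
  \<comment> \<open>Pythagoras: the excess energy of \<open>v\<close> over \<open>p\<close> is the
    squared norm of \<open>v - p\<close>, which settles both minimality and uniqueness.\<close>
  have split: "v \<bullet> v = p \<bullet> p + (v - p) \<bullet> (v - p)"
    if v: "v \<in> carrier_vec N" "C *\<^sub>v v = d" for v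
  proof -
    define e where "e = v - p"
    have e: "e \<in> carrier_vec N" and ve: "v = p + e"
      using v p by (auto simp: e_def)
    have Ce: "C *\<^sub>v e = 0\<^sub>v n"
      unfolding e_def mult_minus_distrib_mat_vec[OF C v(1) p] v(2) Cp
      using C v0 by auto
    have PC: "pinv C * C \<in> carrier_mat N N" using P C by auto
    have "p = (pinv C * C) *\<^sub>v v0"
      unfolding p_def v0(2) using C P v0(1) by (simp add: assoc_mult_mat_vec_dim)
    then have "p \<bullet> e = ((pinv C * C) *\<^sub>v e) \<bullet> v0"
      using transpose_vec_mult_scalar[OF PC v0(1) e] sym e p v0(1) PC
      by (metis comm_scalar_prod mult_mat_vec_carrier)
    also have "(pinv C * C) *\<^sub>v e = 0\<^sub>v N"
      using C P e Ce by (auto simp: assoc_mult_mat_vec_dim)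
    finally have pe: "p \<bullet> e = 0" using v0(1) by simp
    then have "e \<bullet> p = 0" using comm_scalar_prod[OF p e] by simp
    with pe show ?thesis
      unfolding e_def[symmetric] unfolding ve using p e
      by (simp add: add_scalar_prod_distrib[of _ N] scalar_prod_add_distrib[of _ N])
  qed
  have nonneg: "0 \<le> w \<bullet> w" for w :: "real vec"
    by (simp add: scalar_prod_def sum_nonneg)
  show ?thesis unfolding p_def[symmetric]
  proof
    assume "u = p"
    then show "is_arg_min (\<lambda>v. v \<bullet> v) (\<lambda>v. v \<in> carrier_vec N \<and> C *\<^sub>v v = d) u"
      using p Cp split nonneg unfolding is_arg_min_def by (metis le_add_same_cancel1 not_le)
  next
    assume arg: "is_arg_min (\<lambda>v. v \<bullet> v) (\<lambda>v. v \<in> carrier_vec N \<and> C *\<^sub>v v = d) u"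
    then have u: "u \<in> carrier_vec N" "C *\<^sub>v u = d" and "\<not> p \<bullet> p < u \<bullet> u"
      using p Cp unfolding is_arg_min_def by auto
    then have "(u - p) \<bullet> (u - p) = 0"
      using split[OF u] nonneg[of "u - p"] by linarith
    then have z: "u - p = 0\<^sub>v N"
      using real_vec_scalar_self_eq_0[of "u - p" N] u p by auto
    have "u $ i - p $ i = 0" if "i < N" for i
      using arg_cong[OF z, of "\<lambda>w. w $ i"] that p by simp
    then show "u = p" using u p by (intro eq_vecI) auto
  qed
qed

section \<open>Identification from full-row-rank data\<close>

text \<open>A maximal independent set of columns has as many elements as the rank, here
  \<open>nr\<close>, and is therefore a basis of the whole space inside the column space.\<close>

lemma full_row_rank_surj:
  assumes A: "A \<in> carrier_mat nr nc" and "full_row_rank A" and v: "v \<in> carrier_vec nr"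
  shows "\<exists>w\<in>carrier_vec nc. A *\<^sub>v w = v"
proof -
  interpret vec_space "TYPE(real)" nr .
  have rank: "rank A = nr"
    using assms by (auto simp: full_row_rank_def)
  have sub: "set (cols A) \<subseteq> carrier_vec nr"
    using cols_dim[of A] A by simp
  have "\<exists>S. finite S \<and> maximal S (\<lambda>T. T \<subseteq> set (cols A) \<and> lin_indpt T) \<and> {} \<subseteq> S"
    by (rule maximal_exists_superset[where S = "set (cols A)"]) (auto simp: lin_dep_def)
  then obtain S where S: "finite S" "maximal S (\<lambda>T. T \<subseteq> set (cols A) \<and> lin_indpt T)"
    by blast
  then have Sli: "S \<subseteq> set (cols A)" "lin_indpt S" by (auto simp: maximal_def)
  have "card S = nr" using rank_card_indpt[OF A S(2)] rank by simp
  then have "basis S"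
    using S(1) Sli sub by (intro dim_li_is_basis) (auto simp: dim_is_n)
  then have "carrier_vec nr \<subseteq> span S" unfolding basis_def by auto
  also have "\<dots> \<subseteq> col_space A"
    unfolding col_space_def using span_is_monotone Sli(1) by blast
  finally show ?thesis
    using v A unfolding col_space_eq[OF A] by auto
qed

text \<open>The basis is one of the kernel as a space of its own; \<open>span_same\<close> transfers
  its span to the ambient space, where it is the column space of \<open>K\<close>.\<close>

lemma kernel_basis_mat_span:
  assumes A: "A \<in> carrier_mat nr nc" and K: "kernel_basis_mat A K" "K \<in> carrier_mat nc d"
  shows "mat_kernel A = {K *\<^sub>v c | c. c \<in> carrier_vec d}"
proof -
  interpret kernel nr nc A by unfold_locales (rule A)
  have "basis (set (cols K))" using K A by (auto simp: kernel_basis_mat_def)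
  then have "set (cols K) \<subseteq> mat_kernel A" "span (set (cols K)) = mat_kernel A"
    unfolding Ker.basis_def by auto
  then have "mat_kernel A = NC.col_space K"
    unfolding NC.col_space_def using span_same by simp
  also have "\<dots> = {K *\<^sub>v c | c. c \<in> carrier_vec d}"
    unfolding NC.col_space_eq[OF K(2)] using K(2) by auto
  finally show ?thesis .
qed

lemma mult_kernel_basis_mat:
  assumes A: "A \<in> carrier_mat nr nc" and K: "kernel_basis_mat A K" "K \<in> carrier_mat nc d"
  shows "A * K = 0\<^sub>m nr d"
proof (rule mat_eq_by_mult_vec)
  show "A * K \<in> carrier_mat nr d" using A K by auto
  fix c :: "real vec" assume c: "c \<in> carrier_vec d"
  then have "A *\<^sub>v (K *\<^sub>v c) = 0\<^sub>v nr"
    using kernel_basis_mat_span[OF A K] mat_kernelD(2)[OF A] by blast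
  then show "A * K *\<^sub>v c = 0\<^sub>m nr d *\<^sub>v c"
    using A K c by (auto simp: assoc_mult_mat_vec_dim intro!: eq_vecI)
qed auto

text \<open>A preimage under \<open>Y\<close> that \<open>Z\<close> annihilates lies in the range of
  \<open>K\<close>, so \<open>Y * K\<close> is still onto.\<close>

lemma mult_kernel_basis_pinv:
  assumes Y: "Y \<in> carrier_mat p N" and Z: "Z \<in> carrier_mat q N"
    and K: "kernel_basis_mat Z K" "K \<in> carrier_mat N d"
    and surj: "\<And>v. v \<in> carrier_vec p \<Longrightarrow> \<exists>w\<in>carrier_vec N. Y *\<^sub>v w = v \<and> Z *\<^sub>v w = 0\<^sub>v q"
  shows "Y * K * pinv (Y * K) = 1\<^sub>m p"
proof (rule mult_pinv_of_surj)
  show "Y * K \<in> carrier_mat p d" using Y K by auto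
  fix v :: "real vec" assume "v \<in> carrier_vec p"
  then obtain w where w: "w \<in> carrier_vec N" "Y *\<^sub>v w = v" "Z *\<^sub>v w = 0\<^sub>v q"
    using surj by blast
  then have "w \<in> mat_kernel Z" by (intro mat_kernelI[OF Z])
  then obtain c where "c \<in> carrier_vec d" "w = K *\<^sub>v c"
    using kernel_basis_mat_span[OF Z K] by auto
  then show "\<exists>c\<in>carrier_vec d. Y * K *\<^sub>v c = v"
    using w Y K by (intro bexI[of _ c]) (auto simp: assoc_mult_mat_vec_dim)
qed

text \<open>Multiplication by \<open>K\<close> removes the \<open>Z\<close> term, and the right
  inverse of \<open>Y * K\<close> then isolates \<open>F\<close>. The roles of initial states and
  inputs are left open so that one lemma yields both \<open>Q\<close> and \<open>L\<close>.\<close>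

lemma kernel_basis_identifies:
  assumes Y: "Y \<in> carrier_mat p N" and Z: "Z \<in> carrier_mat q N" and K: "kernel_basis_mat Z K"
    and F: "F \<in> carrier_mat n p" and G: "G \<in> carrier_mat n q"
    and surj: "\<And>v. v \<in> carrier_vec p \<Longrightarrow> \<exists>w\<in>carrier_vec N. Y *\<^sub>v w = v \<and> Z *\<^sub>v w = 0\<^sub>v q"
  shows "(F * Y + G * Z) * K * pinv (Y * K) = F"
proof -
  obtain d where Kc: "K \<in> carrier_mat N d"
    using K Z by (auto simp: kernel_basis_mat_def)
  have YK: "Y * K \<in> carrier_mat p d" using Y Kc by auto
  note P = pinv_carrier[OF YK]
  have "(F * Y + G * Z) * K = F * (Y * K) + G * (Z * K)"
    using Y Z Kc F G by (subst add_mult_distrib_mat[of _ n N]) (auto simp: assoc_mult_mat_dim)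
  also have "\<dots> = F * (Y * K)"
    unfolding mult_kernel_basis_mat[OF Z K Kc] using F G YK by (simp add: right_add_zero_mat[of _ n])
  finally have "(F * Y + G * Z) * K * pinv (Y * K) = F * (Y * K * pinv (Y * K))"
    using F YK P by (metis assoc_mult_mat)
  then show ?thesis
    using mult_kernel_basis_pinv[OF Y Z K Kc surj] F by simp
qed

section \<open>Block structure of the controllability matrix\<close>

lemma cols_hcat:
  assumes "\<forall>M\<in>set Ms. dim_row M = n"
  shows "cols (hcat n Ms) = concat (map cols Ms)"
  unfolding hcat_def
proof (rule cols_mat_of_cols)
  show "set (concat (map cols Ms)) \<subseteq> carrier_vec n"
    using assms cols_dim by (auto dest!: subsetD[OF cols_dim])
qed

lemma dim_row_hcat [simp]: "dim_row (hcat n Ms) = n"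
  by (simp add: hcat_def)

lemma dim_col_hcat [simp]: "dim_col (hcat n Ms) = (\<Sum>M\<leftarrow>Ms. dim_col M)"
  by (simp add: hcat_def length_concat o_def)

text \<open>This reduces identities between block matrices to identities between lists of
  columns.\<close>

lemma mat_eq_by_cols:
  assumes "dim_row A = dim_row B" and "cols A = cols B"
  shows "A = B"
  using assms mat_of_cols_cols by metis

lemma hcat_single: "dim_row M = n \<Longrightarrow> hcat n [M] = M"
  by (rule mat_eq_by_cols) (auto simp: cols_hcat)

lemma hcat_append:
  assumes "\<And>M. M \<in> set Ms \<union> set Ns \<Longrightarrow> dim_row M = n"
  shows "hcat n (Ms @ Ns) = hcat n [hcat n Ms, hcat n Ns]"
  by (rule mat_eq_by_cols) (use assms in \<open>auto simp: cols_hcat\<close>)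

lemma cols_mult:
  fixes A B :: "'a :: semiring_0 mat"
  assumes "dim_col A = dim_row B"
  shows "cols (A * B) = map (\<lambda>v. A *\<^sub>v v) (cols B)"
  using assms by (intro nth_equalityI) (auto simp: cols_nth intro!: eq_vecI)

lemma mult_hcat:
  assumes A: "A \<in> carrier_mat r n" and "\<And>M. M \<in> set Ms \<Longrightarrow> dim_row M = n"
  shows "A * hcat n Ms = hcat r (map (\<lambda>M. A * M) Ms)"
proof (rule mat_eq_by_cols)
  have eq: "map (\<lambda>M. map (\<lambda>v. A *\<^sub>v v) (cols M)) Ms = map (\<lambda>M. cols (A * M)) Ms"
    using assms by (auto simp: cols_mult)
  have "cols (A * hcat n Ms) = concat (map (\<lambda>M. map (\<lambda>v. A *\<^sub>v v) (cols M)) Ms)"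
    using assms by (simp add: cols_hcat cols_mult map_concat o_def)
  also have "\<dots> = cols (hcat r (map (\<lambda>M. A * M) Ms))"
    unfolding eq using A by (simp add: cols_hcat o_def)
  finally show "cols (A * hcat n Ms) = cols (hcat r (map (\<lambda>M. A * M) Ms))" .
qed (use A in auto)

lemma hcat_pair_mult_vec:
  assumes A: "A \<in> carrier_mat n a" and B: "B \<in> carrier_mat n b"
    and "v \<in> carrier_vec a" and "w \<in> carrier_vec b"
  shows "hcat n [A, B] *\<^sub>v (v @\<^sub>v w) = A *\<^sub>v v + B *\<^sub>v w"
proof (rule eq_vecI)
  fix i assume "i < dim_vec (A *\<^sub>v v + B *\<^sub>v w)"
  then have i: "i < n" using B by simp
  have "row (hcat n [A, B]) i = row A i @\<^sub>v row B i"
    using A B i by (intro eq_vecI)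
      (auto simp: hcat_def mat_of_cols_index nth_append cols_nth)
  then show "(hcat n [A, B] *\<^sub>v (v @\<^sub>v w)) $ i = (A *\<^sub>v v + B *\<^sub>v w) $ i"
    using assms i by (simp add: scalar_prod_append[of _ a _ b])
qed (use B in auto)

lemma pow_mat_add:
  fixes A :: "'a :: semiring_1 mat"
  assumes A: "A \<in> carrier_mat n n"
  shows "A ^\<^sub>m (a + b) = A ^\<^sub>m a * A ^\<^sub>m b"
  using A by (induction b) (auto simp: assoc_mult_mat_dim)

section \<open>The controllability matrix and the state reached by an input\<close>

lemma ctrb_carrier:
  assumes "A \<in> carrier_mat n n" and "B \<in> carrier_mat n m"
  shows "ctrb A B T \<in> carrier_mat n (m * T)"
  using assms by (intro carrier_matI) (simp_all add: ctrb_def o_def sum_list_triv)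

text \<open>The exponents are split at \<open>a\<close>, and those from \<open>a\<close> on share
  the factor \<open>A ^\<^sub>m a\<close>. In reversed time order the first block acts on the last
  \<open>a\<close> inputs.\<close>

lemma ctrb_add:
  assumes A: "A \<in> carrier_mat n n" and B: "B \<in> carrier_mat n m"
  shows "ctrb A B (a + b) = hcat n [ctrb A B a, A ^\<^sub>m a * ctrb A B b]"
proof -
  have dims: "dim_row A = n" "dim_col A = n" "dim_row B = n" using A B by auto
  have "[0..<a + b] = [0..<a] @ map (\<lambda>t. a + t) [0..<b]"
    using upt_add_eq_append[of 0 a b] map_add_upt[of a b] by (simp add: add.commute)
  then have "ctrb A B (a + b) =
      hcat n (map (\<lambda>t. A ^\<^sub>m t * B) [0..<a] @ map (\<lambda>t. A ^\<^sub>m (a + t) * B) [0..<b])"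
    by (simp add: ctrb_def dims o_def)
  also have "\<dots> = hcat n [ctrb A B a, hcat n (map (\<lambda>t. A ^\<^sub>m (a + t) * B) [0..<b])]"
    using A by (subst hcat_append) (auto simp: ctrb_def)
  also have "hcat n (map (\<lambda>t. A ^\<^sub>m (a + t) * B) [0..<b]) = A ^\<^sub>m a * ctrb A B b"
    unfolding ctrb_def dims
    using A B by (subst mult_hcat[of _ n]) (auto simp: o_def pow_mat_add[OF A] assoc_mult_mat_dim)
  finally show ?thesis .
qed

lemma ctrb_Suc:
  assumes A: "A \<in> carrier_mat n n" and B: "B \<in> carrier_mat n m"
  shows "ctrb A B (Suc T) = hcat n [B, A * ctrb A B T]"
proof -
  have "ctrb A B (Suc 0) = B"
    using A B by (simp add: ctrb_def hcat_single)
  then show ?thesis using ctrb_add[OF A B, of "Suc 0" T] A by simp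
qed

lemma state_cong: "(\<And>t. t < T \<Longrightarrow> u t = u' t) \<Longrightarrow> state A B u x0 T = state A B u' x0 T"
  by (induction T) auto

text \<open>The induction peels off the leading block of \<open>v\<close>, which is the last input,
  so that the recursion of \<open>state\<close> matches \<open>ctrb_Suc\<close>.\<close>

lemma final_state_eq:
  assumes A: "A \<in> carrier_mat n n" and B: "B \<in> carrier_mat n m"
    and x0: "x0 \<in> carrier_vec n" and "v \<in> carrier_vec (m * T)"
  shows "final_state A B T x0 v = A ^\<^sub>m T *\<^sub>v x0 + ctrb A B T *\<^sub>v v"
  using assms(4)
proof (induction T arbitrary: v)
  case 0
  have "ctrb A B 0 *\<^sub>v v = 0\<^sub>v n"
    using ctrb_carrier[OF A B, of 0] 0 by (intro eq_vecI) (auto simp: scalar_prod_def)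
  then show ?case using A x0 by (simp add: final_state_def)
next
  case (Suc T)
  define w where "w = vec_first v m"
  define v' where "v' = vec_last v (m * T)"
  have w: "w \<in> carrier_vec m" and v': "v' \<in> carrier_vec (m * T)"
    by (auto simp: w_def v'_def)
  have v: "v = w @\<^sub>v v'"
    using Suc.prems by (simp add: w_def v'_def)
  have idx: "(T - Suc t) * m + j < m * T" if "t < T" "j < m" for t j
  proof -
    have "(T - Suc t) * m + j < Suc (T - Suc t) * m" using that by simp
    also have "\<dots> \<le> T * m" using that by (intro mult_le_mono1) simp
    finally show ?thesis by (simp add: mult.commute)
  qed
  \<comment> \<open>Lengthening the horizon by one shifts every earlier input by \<open>m\<close>
    entries, the length of \<open>w\<close>, so these inputs are read from
    \<open>v'\<close>.\<close>
  have early: "input_at m (Suc T) v t = input_at m T v' t" if "t < T" for t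
  proof (rule eq_vecI)
    fix j assume j: "j < dim_vec (input_at m T v' t)"
    have "(T - t) * m + j = m + ((T - Suc t) * m + j)"
      using that by (metis Suc_diff_Suc add.assoc mult_Suc)
    then show "input_at m (Suc T) v t $ j = input_at m T v' t $ j"
      using j idx[OF that, of j] w v' by (simp add: input_at_def v)
  qed (simp add: input_at_def)
  have last: "input_at m (Suc T) v T = w"
    using w by (intro eq_vecI) (auto simp: input_at_def v)
  let ?C = "ctrb A B T"
  note C = ctrb_carrier[OF A B, of T]
  have "final_state A B (Suc T) x0 v = A *\<^sub>v final_state A B T x0 v' + B *\<^sub>v w"
    using state_cong[of T, OF early] last B by (simp add: final_state_def)
  also have "\<dots> = A *\<^sub>v (A ^\<^sub>m T *\<^sub>v x0 + ?C *\<^sub>v v') + B *\<^sub>v w"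
    using Suc.IH[OF v'] by simp
  also have "\<dots> = A *\<^sub>v (A ^\<^sub>m T *\<^sub>v x0) + (B *\<^sub>v w + A *\<^sub>v (?C *\<^sub>v v'))"
    using A B C w v' mult_mat_vec_carrier[OF pow_carrier_mat[OF A] x0, of T]
    by (subst mult_add_distrib_mat_vec[of _ n n]) (auto intro!: eq_vecI)
  also have "A *\<^sub>v (A ^\<^sub>m T *\<^sub>v x0) = A ^\<^sub>m Suc T *\<^sub>v x0"
    using pow_mat_add[OF A, of 1 T] A x0 by (simp add: assoc_mult_mat_vec_dim)
  also have "B *\<^sub>v w + A *\<^sub>v (?C *\<^sub>v v') = ctrb A B (Suc T) *\<^sub>v v"
    unfolding ctrb_Suc[OF A B] v using A B C w v'
    by (subst hcat_pair_mult_vec[of _ n m _ "m * T"]) (auto simp: assoc_mult_mat_vec_dim)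
  finally show ?case .
qed

section \<open>Assembling the identified blocks\<close>

lemma rev_prod_empty: "b < a \<Longrightarrow> rev_prod n Q a b = 1\<^sub>m n"
  by (simp add: rev_prod_def)

lemma rev_prod_Suc: "a \<le> Suc b \<Longrightarrow> rev_prod n Q a (Suc b) = Q (Suc b) * rev_prod n Q a b"
  by (simp add: rev_prod_def)

text \<open>All factors are powers of one matrix, so their exponents add up.\<close>

lemma rev_prod_pow:
  assumes A: "A \<in> carrier_mat n n" and "1 \<le> a"
    and "\<And>i. i \<in> {1..l} \<Longrightarrow> Q i = A ^\<^sub>m \<tau> i"
  shows "rev_prod n Q a l = A ^\<^sub>m (\<Sum>i=a..l. \<tau> i)"
  using assms(3)
proof (induction l)
  case 0
  then show ?case using A \<open>1 \<le> a\<close> by (simp add: rev_prod_empty)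
next
  case (Suc l)
  show ?case
  proof (cases "a \<le> Suc l")
    case True
    then show ?thesis
      using Suc pow_mat_add[OF A] by (simp add: rev_prod_Suc add.commute[of _ "\<tau> (Suc l)"])
  next
    case False
    then show ?thesis using A by (simp add: rev_prod_empty)
  qed
qed

text \<open>One more segment multiplies all old blocks by \<open>Q (Suc l)\<close> and puts a new
  block in front, just as \<open>ctrb_add\<close> does for a longer horizon.\<close>

lemma ctrb_hat_Suc:
  assumes "Q (Suc l) \<in> carrier_mat n n" and "dim_row (L (Suc l)) = n"
    and "\<And>i. i \<in> {1..l} \<Longrightarrow> rev_prod n Q (Suc i) l \<in> carrier_mat n n \<and> dim_row (L i) = n"
  shows "ctrb_hat n Q L (Suc l) = hcat n [L (Suc l), Q (Suc l) * ctrb_hat n Q L l]"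
proof -
  define R where "R = (\<lambda>i. rev_prod n Q (Suc i) l * L i)"
  have R: "dim_row (R i) = n" if "1 \<le> i" "i \<le> l" for i
    using assms(3)[of i] that by (auto simp: R_def)
  \<comment> \<open>The product in front of the newest block is empty, hence the identity
    factor.\<close>
  have L: "1\<^sub>m n * L (Suc l) = L (Suc l)"
    using assms(2) by (intro left_mult_one_mat) (auto intro: carrier_matI)
  have eq: "map (\<lambda>i. rev_prod n Q (Suc i) (Suc l) * L i) (rev [1..<Suc l]) =
      map (\<lambda>i. Q (Suc l) * R i) (rev [1..<Suc l])"
  proof (rule map_cong[OF refl])
    fix i assume "i \<in> set (rev [1..<Suc l])"
    then have i: "i \<in> {1..l}" by auto
    then have "rev_prod n Q (Suc i) (Suc l) = Q (Suc l) * rev_prod n Q (Suc i) l"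
      by (simp add: rev_prod_Suc)
    then show "rev_prod n Q (Suc i) (Suc l) * L i = Q (Suc l) * R i"
      using assms(1) assms(3)[OF i] unfolding R_def by (auto intro!: assoc_mult_mat_dim)
  qed
  have "rev [1..<Suc (Suc l)] = Suc l # rev [1..<Suc l]" by simp
  then have "ctrb_hat n Q L (Suc l) =
      hcat n ([L (Suc l)] @ map (\<lambda>i. Q (Suc l) * R i) (rev [1..<Suc l]))"
    using L by (simp only: ctrb_hat_def list.map eq append_Cons append_Nil)
      (simp add: rev_prod_empty)
  also have "\<dots> = hcat n [L (Suc l), hcat n (map (\<lambda>i. Q (Suc l) * R i) (rev [1..<Suc l]))]"
    using assms by (subst hcat_append) (auto simp: hcat_single)
  also have "hcat n (map (\<lambda>i. Q (Suc l) * R i) (rev [1..<Suc l])) = Q (Suc l) * ctrb_hat n Q L l"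
    unfolding ctrb_hat_def R_def[symmetric]
    using assms(1) R by (subst mult_hcat[of _ n]) (auto simp: o_def)
  finally show ?thesis .
qed

lemma ctrb_hat_eq_ctrb:
  assumes A: "A \<in> carrier_mat n n" and B: "B \<in> carrier_mat n m"
    and "\<And>i. i \<in> {1..l} \<Longrightarrow> Q i = A ^\<^sub>m \<tau> i"
    and "\<And>i. i \<in> {1..l} \<Longrightarrow> L i = ctrb A B (\<tau> i)"
  shows "ctrb_hat n Q L l = ctrb A B (\<Sum>i=1..l. \<tau> i)"
  using assms(3,4)
proof (induction l)
  case 0
  then show ?case using A by (simp add: ctrb_hat_def ctrb_def)
next
  case (Suc l)
  have pow: "A ^\<^sub>m j \<in> carrier_mat n n" for j using A by simp
  have rp: "rev_prod n Q (Suc i) l \<in> carrier_mat n n" for i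
    using rev_prod_pow[OF A, of "Suc i" l Q \<tau>] Suc.prems(1) pow by simp
  have Ld: "dim_row (L i) = n" if "i \<in> {1..Suc l}" for i
    unfolding Suc.prems(2)[OF that] by (rule carrier_matD(1)[OF ctrb_carrier[OF A B]])
  have "ctrb_hat n Q L (Suc l) = hcat n [L (Suc l), Q (Suc l) * ctrb_hat n Q L l]"
    using Suc.prems(1)[of "Suc l"] pow rp Ld by (intro ctrb_hat_Suc) auto
  also have "\<dots> = ctrb A B (\<tau> (Suc l) + (\<Sum>i=1..l. \<tau> i))"
    unfolding ctrb_add[OF A B] using Suc by simp
  finally show ?case by (simp add: add.commute)
qed

section \<open>Data-driven minimum-energy control\<close>

text \<open>Reaching \<open>xf\<close> is a linear equation in the stacked input, solvable by
  reachability, so \<open>min_norm_solution\<close> applies.\<close>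

lemma min_energy_control_iff:
  assumes A: "A \<in> carrier_mat n n" and B: "B \<in> carrier_mat n m"
    and x0: "x0 \<in> carrier_vec n" and xf: "xf \<in> carrier_vec n"
    and reach: "reachable A B T x0 xf"
  shows "min_energy_control A B T x0 xf u \<longleftrightarrow>
    u = pinv (ctrb A B T) *\<^sub>v (xf - A ^\<^sub>m T *\<^sub>v x0)"
proof -
  note C = ctrb_carrier[OF A B, of T]
  have Ax: "A ^\<^sub>m T *\<^sub>v x0 \<in> carrier_vec n"
    using mult_mat_vec_carrier[OF pow_carrier_mat[OF A] x0] .
  have "final_state A B T x0 v = xf \<longleftrightarrow> ctrb A B T *\<^sub>v v = xf - A ^\<^sub>m T *\<^sub>v x0"
    if v: "v \<in> carrier_vec (m * T)" for v
  proof -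
    have "a + c = xf \<longleftrightarrow> c = xf - a" if "a \<in> carrier_vec n" "c \<in> carrier_vec n" for a c
      using that xf by (auto simp: vec_eq_iff algebra_simps)
    then show ?thesis
      unfolding final_state_eq[OF A B x0 v] using mult_mat_vec_carrier[OF C v] Ax by blast
  qed
  then have "(\<lambda>v. v \<in> carrier_vec (m * T) \<and> final_state A B T x0 v = xf) =
      (\<lambda>v. v \<in> carrier_vec (m * T) \<and> ctrb A B T *\<^sub>v v = xf - A ^\<^sub>m T *\<^sub>v x0)"
    by blast
  then show ?thesis
    unfolding min_energy_control_def carrier_matD(2)[OF B]
    using min_norm_solution[OF C reach[unfolded reachable_def]] by simp
qed

lemma dataset_final_states:
  assumes A: "A \<in> carrier_mat n n" and B: "B \<in> carrier_mat n m"
    and data: "generated_dataset A B M Ts N U X0 X" and k: "k \<in> {1..M}"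
  shows "X k = A ^\<^sub>m Ts k * X0 k + ctrb A B (Ts k) * U k"
proof (rule mat_col_eqI)
  have dims: "U k \<in> carrier_mat (m * Ts k) (N k)" "X0 k \<in> carrier_mat n (N k)"
      "X k \<in> carrier_mat n (N k)"
    and cols: "\<And>j. j < N k \<Longrightarrow> col (X k) j = final_state A B (Ts k) (col (X0 k) j) (col (U k) j)"
    using data k A B unfolding generated_dataset_def by auto
  note C = ctrb_carrier[OF A B, of "Ts k"] and P = pow_carrier_mat[OF A, of "Ts k"]
  show "dim_row (X k) = dim_row (A ^\<^sub>m Ts k * X0 k + ctrb A B (Ts k) * U k)"
    "dim_col (X k) = dim_col (A ^\<^sub>m Ts k * X0 k + ctrb A B (Ts k) * U k)"
    using dims C by auto
  fix j assume "j < dim_col (A ^\<^sub>m Ts k * X0 k + ctrb A B (Ts k) * U k)"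
  then have j: "j < N k" using dims by simp
  have "col (X k) j = A ^\<^sub>m Ts k *\<^sub>v col (X0 k) j + ctrb A B (Ts k) *\<^sub>v col (U k) j"
    unfolding cols[OF j] using dims j by (intro final_state_eq[OF A B]) auto
  also have "\<dots> = col (A ^\<^sub>m Ts k * X0 k + ctrb A B (Ts k) * U k) j"
    using col_mult2[OF P dims(2) j] col_mult2[OF C dims(1) j] j dims C P
    by (subst col_add[of _ n "N k"]) (auto simp del: col_mult2)
  finally show "col (X k) j = col (A ^\<^sub>m Ts k * X0 k + ctrb A B (Ts k) * U k) j" .
qed

text \<open>This is the form in which the rank assumption enters: initial state and input can be
  prescribed independently, in particular one of them as zero.\<close>

lemma full_row_rank_append_rows_surj:
  assumes Y: "Y \<in> carrier_mat p N" and Z: "Z \<in> carrier_mat q N" and "full_row_rank (Y @\<^sub>r Z)"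
    and v: "v \<in> carrier_vec p" and w: "w \<in> carrier_vec q"
  shows "\<exists>x\<in>carrier_vec N. Y *\<^sub>v x = v \<and> Z *\<^sub>v x = w"
proof -
  obtain x where x: "x \<in> carrier_vec N" "(Y @\<^sub>r Z) *\<^sub>v x = v @\<^sub>v w"
    using full_row_rank_surj[OF carrier_append_rows[OF Y Z] assms(3)] v w
    by (meson append_carrier_vec)
  have "Y *\<^sub>v x = v \<and> Z *\<^sub>v x = w"
    using x(2)[unfolded mat_mult_append[OF Y Z x(1)]] Y v x(1)
    by (subst (asm) append_vec_eq[of _ p]) auto
  then show ?thesis using x(1) by blast
qed

theorem theorem4p2:
  fixes A B :: "real mat" and x0 xf u :: "real vec"
    and n m M T l :: nat and Ts N k :: "nat \<Rightarrow> nat"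
    and U X0 X KU KX0 Q L :: "nat \<Rightarrow> real mat"
  assumes "A \<in> carrier_mat n n" and "B \<in> carrier_mat n m"
    and "generated_dataset A B M Ts N U X0 X"
    and "\<And>i. i \<in> {1..M} \<Longrightarrow> kernel_basis_mat (U i) (KU i)"
    and "\<And>i. i \<in> {1..M} \<Longrightarrow> kernel_basis_mat (X0 i) (KX0 i)"
    and "T \<ge> 1"
    and "\<And>i. i \<in> {1..l} \<Longrightarrow> k i \<in> {1..M}"
    and "(\<Sum>i=1..l. Ts (k i)) = T"
    and "x0 \<in> carrier_vec n" and "xf \<in> carrier_vec n"
    and "reachable A B T x0 xf"
    and "\<And>i. i \<in> {1..l} \<Longrightarrow> full_row_rank (X0 (k i) @\<^sub>r U (k i))"
    and "\<And>i. i \<in> {1..l} \<Longrightarrow> Q i = X (k i) * KU (k i) * pinv (X0 (k i) * KU (k i))"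
    and "\<And>i. i \<in> {1..l} \<Longrightarrow> L i = X (k i) * KX0 (k i) * pinv (U (k i) * KX0 (k i))"
  shows "min_energy_control A B T x0 xf u \<longleftrightarrow>
    u = pinv (ctrb_hat n Q L l) *\<^sub>v (hcat n [- rev_prod n Q 1 l, 1\<^sub>m n] *\<^sub>v (x0 @\<^sub>v xf))"
proof -
  note A = assms(1) and B = assms(2) and data = assms(3) and x0 = assms(9) and xf = assms(10)
  define \<tau> where "\<tau> i = Ts (k i)" for i
  have ident: "Q i = A ^\<^sub>m \<tau> i \<and> L i = ctrb A B (\<tau> i)" if i: "i \<in> {1..l}" for i
  proof -
    note k = assms(7)[OF i]
    have U: "U (k i) \<in> carrier_mat (m * \<tau> i) (N (k i))" and X0: "X0 (k i) \<in> carrier_mat n (N (k i))"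
      using data k A B unfolding generated_dataset_def \<tau>_def by auto
    have P: "A ^\<^sub>m \<tau> i \<in> carrier_mat n n" and C: "ctrb A B (\<tau> i) \<in> carrier_mat n (m * \<tau> i)"
      using pow_carrier_mat[OF A] ctrb_carrier[OF A B] by auto
    have X: "X (k i) = A ^\<^sub>m \<tau> i * X0 (k i) + ctrb A B (\<tau> i) * U (k i)"
      using dataset_final_states[OF A B data k] by (simp add: \<tau>_def)
    \<comment> \<open>The summands are exchanged so that \<open>kernel_basis_identifies\<close> also
      applies with \<open>U\<close> in place of \<open>X0\<close>.\<close>
    then have X': "X (k i) = ctrb A B (\<tau> i) * U (k i) + A ^\<^sub>m \<tau> i * X0 (k i)"
      using comm_add_mat[OF mult_carrier_mat[OF P X0] mult_carrier_mat[OF C U]] by simp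
    note surj = full_row_rank_append_rows_surj[OF X0 U assms(12)[OF i]]
    have "Q i = A ^\<^sub>m \<tau> i"
      unfolding assms(13)[OF i] X
      by (rule kernel_basis_identifies[OF X0 U assms(4)[OF k] P C]) (use surj in auto)
    moreover have "L i = ctrb A B (\<tau> i)"
      unfolding assms(14)[OF i] X'
      by (rule kernel_basis_identifies[OF U X0 assms(5)[OF k] C P]) (use surj[OF zero_carrier_vec] in fast)
    ultimately show ?thesis ..
  qed
  have T: "(\<Sum>i=1..l. \<tau> i) = T" using assms(8) by (simp add: \<tau>_def)
  have Chat: "ctrb_hat n Q L l = ctrb A B T"
    using ctrb_hat_eq_ctrb[OF A B, of l Q \<tau> L] ident T by simp
  have R: "rev_prod n Q 1 l = A ^\<^sub>m T"
    using rev_prod_pow[OF A, of 1 l Q \<tau>] ident T by simp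
  note P = pow_carrier_mat[OF A, of T]
  have "hcat n [- (A ^\<^sub>m T), 1\<^sub>m n] *\<^sub>v (x0 @\<^sub>v xf) = - (A ^\<^sub>m T) *\<^sub>v x0 + 1\<^sub>m n *\<^sub>v xf"
    by (rule hcat_pair_mult_vec) (use P x0 xf in auto)
  also have "\<dots> = xf - A ^\<^sub>m T *\<^sub>v x0"
    using A P x0 xf by (intro eq_vecI) auto
  finally show ?thesis
    unfolding Chat R using min_energy_control_iff[OF A B x0 xf assms(11)] by simp
qed

end
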